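(* Let $X$ and $Y$ be topological spaces such that $Y$ is semilocally simply connected, and let $F: X \to Y$ be a shy surjection, with $F(x_0)=y_0$, where $x_0 \in X$ and $y_0 \in Y$. Then the induced homomorphism of fundamental groups $F_*: \Pi_1(X,x_0) \to \Pi_1(Y,y_0)$, defined by $F_*([f])= [F \circ f]$ for every pointed loop $f: (S^1,s_0) \to (X,x_0)$, is onto.
   Context: A function $f: X \to Y$ between topological spaces is shy if $f$ is continuous and for every path-connected $Y' \subset f(X)$, $f^{-1}(Y')$ is a path-connected subset of $X$. A topological space $Y$ is semilocally simply connected if for every $y \in Y$ there is a neighborhood $N_y$ of $y$ in $Y$ such that every loop in $N_y$ is nullhomotopic in $Y$. $S^1$ is the unit circle in the Euclidean plane with base point $s_0$, and $\Pi_1(X,x_0)$ denotes the fundamental group of $X$ based at $x_0$. *)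

theory Defs
  imports "HOL-Analysis.Analysis" "HOL-Algebra.Group"
begin

definition shy_map :: "'a topology \<Rightarrow> 'b topology \<Rightarrow> ('a \<Rightarrow> 'b) \<Rightarrow> bool" where
  "shy_map X Y f \<longleftrightarrow>
     continuous_map X Y f \<and>
     (\<forall>Y'. Y' \<subseteq> f ` topspace X \<and> path_connectedin Y Y' \<longrightarrow>
           path_connectedin X {x \<in> topspace X. f x \<in> Y'})"

abbreviation circle_top :: "complex topology" where
  "circle_top \<equiv> top_of_set (sphere 0 1)"

definition nullhomotopic_loop :: "'a topology \<Rightarrow> (complex \<Rightarrow> 'a) \<Rightarrow> bool" where
  "nullhomotopic_loop X f \<longleftrightarrow> (\<exists>c. homotopic_with (\<lambda>_. True) circle_top X f (\<lambda>_. c))"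

text \<open>The neighbourhood \<open>N\<close> is not required to be open.\<close>

definition semilocally_simply_connected_space :: "'a topology \<Rightarrow> bool" where
  "semilocally_simply_connected_space Y \<longleftrightarrow>
     (\<forall>y \<in> topspace Y. \<exists>N. N \<subseteq> topspace Y \<and> (\<exists>U. openin Y U \<and> y \<in> U \<and> U \<subseteq> N) \<and>
        (\<forall>f. continuous_map circle_top (subtopology Y N) f \<longrightarrow> nullhomotopic_loop Y f))"

text \<open>The base point of the circle is \<open>1\<close>.\<close>

definition pointed_loops :: "'a topology \<Rightarrow> 'a \<Rightarrow> (complex \<Rightarrow> 'a) set" where
  "pointed_loops X x0 = {f. continuous_map circle_top X f \<and> f 1 = x0}"

text \<open>
  Values of loops off the circle are irrelevant: loops that agree on the circle
  lie in the same class.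
\<close>

definition loop_class :: "'a topology \<Rightarrow> 'a \<Rightarrow> (complex \<Rightarrow> 'a) \<Rightarrow> (complex \<Rightarrow> 'a) set" where
  "loop_class X x0 f = {g. homotopic_with (\<lambda>h. h 1 = x0) circle_top X f g}"

text \<open>
  With \<open>z = exp (i \<theta>)\<close>, the loop \<open>loop_join f g\<close> traverses \<open>f\<close> at double speed for
  \<open>\<theta> \<in> [0, \<pi>]\<close> and then \<open>g\<close> at double speed for \<open>\<theta> \<in> [\<pi>, 2\<pi>]\<close>.
\<close>

definition loop_join :: "(complex \<Rightarrow> 'a) \<Rightarrow> (complex \<Rightarrow> 'a) \<Rightarrow> complex \<Rightarrow> 'a" where
  "loop_join f g = (\<lambda>z. if 0 \<le> Im z then f (z\<^sup>2) else g (z\<^sup>2))"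

definition fundamental_group :: "'a topology \<Rightarrow> 'a \<Rightarrow> (complex \<Rightarrow> 'a) set monoid" where
  "fundamental_group X x0 =
     \<lparr>carrier = loop_class X x0 ` pointed_loops X x0,
      monoid.mult = (\<lambda>c d. \<Union>f\<in>c. \<Union>g\<in>d. loop_class X x0 (loop_join f g)),
      one = loop_class X x0 (\<lambda>_. x0)\<rparr>"

definition induced_hom ::
    "'b topology \<Rightarrow> 'b \<Rightarrow> ('a \<Rightarrow> 'b) \<Rightarrow> (complex \<Rightarrow> 'a) set \<Rightarrow> (complex \<Rightarrow> 'b) set" where
  "induced_hom Y y0 F c = (\<Union>f\<in>c. loop_class Y y0 (F \<circ> f))"

text \<open>The two unions above are well defined on classes.\<close>

lemma loop_class_self: "f \<in> pointed_loops X x0 \<Longrightarrow> f \<in> loop_class X x0 f"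
  by (simp add: loop_class_def pointed_loops_def)

lemma loop_class_eq:
  assumes "g \<in> loop_class X x0 f"
  shows "loop_class X x0 g = loop_class X x0 f"
  using assms unfolding loop_class_def mem_Collect_eq
  by (intro Collect_cong) (meson homotopic_with_trans homotopic_with_symD)

lemma loop_join_cong_class:
  assumes f: "f' \<in> loop_class X x0 f" and g: "g' \<in> loop_class X x0 g"
  shows "loop_join f' g' \<in> loop_class X x0 (loop_join f g)"
proof -
  let ?C = "prod_topology (top_of_set {0..1::real}) circle_top"
  obtain h where h: "continuous_map ?C X h" "\<And>x. h (0, x) = f x" "\<And>x. h (1, x) = f' x"
      "\<And>t. t \<in> {0..1} \<Longrightarrow> h (t, 1) = x0"
    using f unfolding loop_class_def homotopic_with_def by auto
  obtain k where k: "continuous_map ?C X k" "\<And>x. k (0, x) = g x" "\<And>x. k (1, x) = g' x"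
      "\<And>t. t \<in> {0..1} \<Longrightarrow> k (t, 1) = x0"
    using g unfolding loop_class_def homotopic_with_def by auto
  have C: "?C = top_of_set ({0..1} \<times> sphere 0 1)"
    by simp
  have sq: "continuous_map ?C ?C (\<lambda>x. (fst x, (snd x)\<^sup>2))"
    unfolding C continuous_map_subtopology_eu
    by (intro conjI continuous_intros) (auto simp: norm_power)
  have hsq: "continuous_map ?C X (\<lambda>x. h (fst x, (snd x)\<^sup>2))"
    and ksq: "continuous_map ?C X (\<lambda>x. k (fst x, (snd x)\<^sup>2))"
    using continuous_map_compose[OF sq h(1)] continuous_map_compose[OF sq k(1)]
    by (simp_all add: o_def)
  have im: "continuous_map ?C euclideanreal (\<lambda>x. Im (snd x))"
    unfolding C continuous_map_subtopology_eu
    by (simp, intro continuous_intros)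
  have "continuous_map ?C X
      (\<lambda>x. if 0 \<le> Im (snd x) then h (fst x, (snd x)\<^sup>2) else k (fst x, (snd x)\<^sup>2))"
  proof (rule continuous_map_cases_le[OF _ im])
    fix x assume x: "x \<in> topspace ?C" "0 = Im (snd x)"
    then have "(snd x)\<^sup>2 = 1"
      by (auto simp: complex_eq_iff power2_eq_square norm_complex_def abs_if split: if_splits)
    with x show "h (fst x, (snd x)\<^sup>2) = k (fst x, (snd x)\<^sup>2)"
      using h(4) k(4) by auto
  qed (use hsq ksq in \<open>auto intro: continuous_map_from_subtopology\<close>)
  then show ?thesis
    unfolding loop_class_def homotopic_with_def mem_Collect_eq
    by (intro exI[of _ "\<lambda>x. if 0 \<le> Im (snd x) then h (fst x, (snd x)\<^sup>2) else k (fst x, (snd x)\<^sup>2)"])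
       (simp add: loop_join_def h k)
qed

lemma fundamental_group_mult:
  assumes "f \<in> pointed_loops X x0" "g \<in> pointed_loops X x0"
  shows "loop_class X x0 f \<otimes>\<^bsub>fundamental_group X x0\<^esub> loop_class X x0 g
         = loop_class X x0 (loop_join f g)"
proof -
  have "loop_class X x0 (loop_join f' g') = loop_class X x0 (loop_join f g)"
    if "f' \<in> loop_class X x0 f" "g' \<in> loop_class X x0 g" for f' g'
    using that by (intro loop_class_eq loop_join_cong_class)
  then have "(\<Union>f'\<in>loop_class X x0 f. \<Union>g'\<in>loop_class X x0 g. loop_class X x0 (loop_join f' g')) =
             (\<Union>f'\<in>loop_class X x0 f. \<Union>g'\<in>loop_class X x0 g. loop_class X x0 (loop_join f g))"
    by (intro SUP_cong refl)
  also have "\<dots> = loop_class X x0 (loop_join f g)"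
    using loop_class_self[OF assms(1)] loop_class_self[OF assms(2)] by fast
  finally show ?thesis
    by (simp add: fundamental_group_def)
qed

lemma induced_hom_class:
  assumes F: "continuous_map X Y F" "F x0 = y0" and f: "f \<in> pointed_loops X x0"
  shows "induced_hom Y y0 F (loop_class X x0 f) = loop_class Y y0 (F \<circ> f)"
proof -
  have "F \<circ> g \<in> loop_class Y y0 (F \<circ> f)" if "g \<in> loop_class X x0 f" for g
    using that F unfolding loop_class_def mem_Collect_eq
    by (elim homotopic_with_compose_continuous_map_left) auto
  then have "loop_class Y y0 (F \<circ> g) = loop_class Y y0 (F \<circ> f)" if "g \<in> loop_class X x0 f" for g
    using that by (intro loop_class_eq)
  then have "(\<Union>g\<in>loop_class X x0 f. loop_class Y y0 (F \<circ> g)) =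
             (\<Union>g\<in>loop_class X x0 f. loop_class Y y0 (F \<circ> f))"
    by (intro SUP_cong refl)
  also have "\<dots> = loop_class Y y0 (F \<circ> f)"
    using loop_class_self[OF f] by fast
  finally show ?thesis
    by (simp add: induced_hom_def)
qed

end

theory Submission
  imports Defs
begin

text \<open>
  That the induced map is a homomorphism is formal, because composing with \<open>F\<close> commutes with
  joining loops.  The point is surjectivity: a loop \<open>f\<close> in \<open>Y\<close> has to be lifted, up to a homotopy
  fixing the base point, to a loop in \<open>X\<close>.

  Unroll \<open>f\<close> to the path \<open>g t = f (cis (2 * pi * t))\<close>.  Around every parameter there is an interval
  on which \<open>g\<close> stays in a set \<open>N\<close> all of whose loops are nullhomotopic in \<open>Y\<close>.  Let \<open>[a, b]\<close> be so
  short, and choose any points \<open>x\<close>, \<open>x'\<close> of \<open>X\<close> over \<open>g a\<close> and \<open>g b\<close>.  The image \<open>g ` {a..b}\<close> is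
  path-connected, so by shyness its preimage is too, and \<open>x\<close> and \<open>x'\<close> are joined by a path \<open>q\<close> whose
  projection stays in \<open>g ` {a..b}\<close>.  The path \<open>g\<close> followed by the reverse of \<open>F \<circ> q\<close> is then a loop
  in \<open>N\<close>; it bounds a disc in \<open>Y\<close>, and this disc is a homotopy, fixing both ends, from \<open>g\<close> to
  \<open>F \<circ> q\<close> (\<open>homotopic_rel_ends_if_small\<close>, \<open>shy_map_lift_small_path\<close>).

  Since the ends of the lifts can be prescribed freely in the fibres, lifts over adjacent intervals
  can be made to match, and they and the homotopies are glued.  Bolzano's bisection principle thus
  extends the claim from short intervals to \<open>[0, 1]\<close> (\<open>shy_map_lift_path\<close>).  Prescribing the base
  point at both ends, the lift closes up to a loop.
\<close>

section \<open>Homotopies of paths with fixed ends\<close>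

definition homotopic_rel_ends ::
    "'a topology \<Rightarrow> real \<Rightarrow> real \<Rightarrow> (real \<Rightarrow> 'a) \<Rightarrow> (real \<Rightarrow> 'a) \<Rightarrow> bool" where
  "homotopic_rel_ends Y a b u v \<longleftrightarrow>
     homotopic_with (\<lambda>h. h a = u a \<and> h b = u b) (top_of_set {a..b}) Y u v"

text \<open>
  In a homotopy only the values over the space itself matter; this form of the definition spares
  the gluing arguments below all bookkeeping of values elsewhere.
\<close>

lemma homotopic_rel_ends_iff:
  assumes "a \<le> b"
  shows "homotopic_rel_ends Y a b u v \<longleftrightarrow>
     (\<exists>h. continuous_map (top_of_set ({0..1::real} \<times> {a..b})) Y h \<and>
          (\<forall>t\<in>{a..b}. h (0, t) = u t) \<and> (\<forall>t\<in>{a..b}. h (1, t) = v t) \<and>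
          (\<forall>s\<in>{0..1}. h (s, a) = u a \<and> h (s, b) = u b))"
  unfolding homotopic_rel_ends_def using assms by (subst homotopic_with) auto

lemma homotopic_rel_ends_glue:
  assumes "a \<le> b" "b \<le> c" "homotopic_rel_ends Y a b u v" "homotopic_rel_ends Y b c u v"
  shows "homotopic_rel_ends Y a c u v"
proof -
  obtain h where h: "continuous_map (top_of_set ({0..1::real} \<times> {a..b})) Y h"
      "\<forall>t\<in>{a..b}. h (0, t) = u t" "\<forall>t\<in>{a..b}. h (1, t) = v t"
      "\<forall>s\<in>{0..1}. h (s, a) = u a \<and> h (s, b) = u b"
    using assms by (auto simp: homotopic_rel_ends_iff)
  obtain k where k: "continuous_map (top_of_set ({0..1::real} \<times> {b..c})) Y k"
      "\<forall>t\<in>{b..c}. k (0, t) = u t" "\<forall>t\<in>{b..c}. k (1, t) = v t"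
      "\<forall>s\<in>{0..1}. k (s, b) = u b \<and> k (s, c) = u c"
    using assms by (auto simp: homotopic_rel_ends_iff)
  define H where "H = (\<lambda>p::real\<times>real. if snd p \<le> b then h p else k p)"
  let ?R = "top_of_set ({0..1::real} \<times> {a..c})"
  have "continuous_map ?R Y H"
    unfolding H_def
  proof (rule continuous_map_cases_le)
    show "continuous_map ?R euclideanreal snd"
      by (simp add: continuous_on_snd)
    have "{0..1} \<times> {a..c} \<inter> {p. p \<in> topspace ?R \<and> snd p \<le> b} = {0..1} \<times> {a..b}"
      "{0..1} \<times> {a..c} \<inter> {p. p \<in> topspace ?R \<and> b \<le> snd p} = {0..1} \<times> {b..c}"
      using assms(1,2) by auto
    then show "continuous_map (subtopology ?R {p. p \<in> topspace ?R \<and> snd p \<le> b}) Y h"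
      "continuous_map (subtopology ?R {p. p \<in> topspace ?R \<and> b \<le> snd p}) Y k"
      using h(1) k(1) by (simp_all add: subtopology_subtopology)
  qed (use h(4) k(4) in auto)
  moreover have "\<forall>t\<in>{a..c}. H (0, t) = u t" "\<forall>t\<in>{a..c}. H (1, t) = v t"
    using h(2,3) k(2,3) by (auto simp: H_def)
  moreover have "\<forall>s\<in>{0..1}. H (s, a) = u a \<and> H (s, c) = u c"
    using h(4) k(4) assms(1,2) by (auto simp: H_def dest: order_antisym)
  ultimately show ?thesis
    using assms(1,2) by (subst homotopic_rel_ends_iff) auto
qed

section \<open>Homotopies filling nullhomotopic loops\<close>

text \<open>
  The disc is the quotient of the cylinder \<open>[0, 1] \<times> S\<^sup>1\<close> by \<open>(s, z) \<mapsto> (1 - s) z\<close>, which collapses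
  the top of the cylinder to the centre; there a nullhomotopy is constant.
\<close>

lemma nullhomotopic_loop_extends_to_disc:
  assumes "nullhomotopic_loop Y l"
  obtains D where "continuous_map (top_of_set (cball 0 1)) Y D" "\<And>z. norm z = 1 \<Longrightarrow> D z = l z"
proof -
  let ?C = "top_of_set ({0..1::real} \<times> sphere (0::complex) 1)"
  let ?e = "\<lambda>p::real\<times>complex. (1 - fst p) *\<^sub>R snd p"
  obtain c h where h: "continuous_map ?C Y h" "\<And>z. h (0, z) = l z" "\<And>z. h (1, z) = c"
    using assms by (auto simp: nullhomotopic_loop_def homotopic_with_def)
  have "quotient_map ?C (top_of_set (cball 0 1)) ?e"
  proof (rule T1_Spaces.continuous_imp_quotient_map)
    show "continuous_map ?C (top_of_set (cball 0 1)) ?e"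
      unfolding continuous_map_subtopology_eu
      by (intro conjI continuous_intros) auto
    show "compact_space ?C"
      by (simp add: compact_space_subtopology compact_Times)
    show "Hausdorff_space (top_of_set (cball (0::complex) 1))"
      by (simp add: Hausdorff_space_subtopology)
    show "?e ` topspace ?C = topspace (top_of_set (cball 0 1))"
    proof
      show "?e ` topspace ?C \<subseteq> topspace (top_of_set (cball 0 1))"
        by auto
      show "topspace (top_of_set (cball 0 1)) \<subseteq> ?e ` topspace ?C"
      proof
        fix w :: complex assume w: "w \<in> topspace (top_of_set (cball 0 1))"
        show "w \<in> ?e ` topspace ?C"
        proof (cases "w = 0")
          case True
          then show ?thesis by (intro image_eqI[of _ _ "(1, 1)"]) auto
        next
          case False
          then show ?thesis using w
            by (intro image_eqI[of _ _ "(1 - norm w, sgn w)"])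
               (auto simp: norm_sgn sgn_div_norm)
        qed
      qed
    qed
  qed
  then obtain D where D: "continuous_map (top_of_set (cball 0 1)) Y D"
      "\<And>p. p \<in> topspace ?C \<Longrightarrow> D (?e p) = h p"
  proof (rule quotient_map_lift_exists[OF _ h(1)])
    fix p q assume pq: "p \<in> topspace ?C" "q \<in> topspace ?C" "?e p = ?e q"
    have norm_e: "norm (?e r) = 1 - fst r" if "r \<in> topspace ?C" for r
      using that by auto
    from norm_e[OF pq(1)] norm_e[OF pq(2)] pq(3) have "1 - fst p = 1 - fst q" by metis
    then have 1: "fst p = fst q" by simp
    with pq(3) have "fst p = 1 \<or> snd p = snd q" by auto
    with 1 h(3) show "h p = h q" by (metis prod.collapse)
  qed blast
  show thesis
  proof
    fix z :: complex assume "norm z = 1"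
    then show "D z = l z" using D(2)[of "(0, z)"] h(2) by simp
  qed (fact D(1))
qed

text \<open>
  Run along \<open>u\<close> on the upper and along \<open>v\<close> on the lower half of the circle, both from \<open>-1\<close> to \<open>1\<close>.
  A disc filling this loop is swept out by its vertical chords, and moving along these downwards
  deforms \<open>u\<close> into \<open>v\<close> while the ends \<open>-1\<close> and \<open>1\<close> stay in place.
\<close>

lemma homotopic_rel_ends_if_small:
  assumes small: "\<And>l. continuous_map circle_top (subtopology Y N) l \<Longrightarrow> nullhomotopic_loop Y l"
    and u: "continuous_map (top_of_set {a..b}) (subtopology Y N) u"
    and v: "continuous_map (top_of_set {a..b}) (subtopology Y N) v"
    and ends: "u a = v a" "u b = v b" and "a < b"
  shows "homotopic_rel_ends Y a b u v"
proof -
  define r where "r = (\<lambda>x. a + (b - a) * ((1 + x) / 2))"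
  define \<tau> where "\<tau> = (\<lambda>t. 2 * ((t - a) / (b - a)) - 1)"
  define l where "l = (\<lambda>z. if 0 \<le> Im z then u (r (Re z)) else v (r (Re z)))"
  have r\<tau>: "r (\<tau> t) = t" for t
    using \<open>a < b\<close> by (simp add: r_def \<tau>_def) (simp add: field_simps)
  have r_ends: "r (-1) = a" "r 1 = b" and \<tau>_ends: "\<tau> a = -1" "\<tau> b = 1"
    using \<open>a < b\<close> by (simp_all add: r_def \<tau>_def field_simps)
  have \<tau>_bounds: "- 1 \<le> \<tau> t" "\<tau> t \<le> 1" if "t \<in> {a..b}" for t
    using that \<open>a < b\<close> by (auto simp: \<tau>_def field_simps)
  have \<tau>_sq: "(\<tau> t)\<^sup>2 \<le> 1" if "t \<in> {a..b}" for t
    using \<tau>_bounds[OF that] by (simp add: abs_square_le_1)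
  have r_mem: "r x \<in> {a..b}" if "\<bar>x\<bar> \<le> 1" for x
  proof -
    have "0 \<le> (1 + x) / 2" "(1 + x) / 2 \<le> 1"
      using that by auto
    then show ?thesis
      using \<open>a < b\<close> mult_left_le[of "(1 + x) / 2" "b - a"] by (simp add: r_def)
  qed
  have "continuous_map circle_top (subtopology Y N) l"
    unfolding l_def
  proof (rule continuous_map_cases_le)
    show "continuous_map circle_top euclideanreal Im"
      by (simp add: continuous_on_Im)
    have c: "continuous_map circle_top (top_of_set {a..b}) (\<lambda>z. r (Re z))"
      unfolding continuous_map_subtopology_eu
    proof
      show "continuous_on (sphere 0 1) (\<lambda>z. r (Re z))"
        unfolding r_def by (intro continuous_intros) auto
      show "(\<lambda>z. r (Re z)) \<in> sphere 0 1 \<rightarrow> {a..b}"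
      proof
        fix z :: complex assume "z \<in> sphere 0 1"
        then show "r (Re z) \<in> {a..b}"
          using abs_Re_le_cmod[of z] by (intro r_mem) simp
      qed
    qed
    show "continuous_map (subtopology circle_top {z. z \<in> topspace circle_top \<and> 0 \<le> Im z})
            (subtopology Y N) (\<lambda>z. u (r (Re z)))"
      "continuous_map (subtopology circle_top {z. z \<in> topspace circle_top \<and> Im z \<le> 0})
            (subtopology Y N) (\<lambda>z. v (r (Re z)))"
      using continuous_map_compose[OF c u] continuous_map_compose[OF c v]
      by (auto simp: o_def intro: continuous_map_from_subtopology)
    fix z assume "z \<in> topspace circle_top" "0 = Im z"
    then have "Re z = -1 \<or> Re z = 1"
      by (auto simp: norm_complex_def)
    then show "u (r (Re z)) = v (r (Re z))"
      using ends r_ends by auto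
  qed simp_all
  then obtain D where D: "continuous_map (top_of_set (cball 0 1)) Y D"
      "\<And>z. norm z = 1 \<Longrightarrow> D z = l z"
    using small nullhomotopic_loop_extends_to_disc by metis
  \<comment> \<open>For fixed \<open>t\<close> this runs down the vertical chord of the unit disc over \<open>\<tau> t\<close>.\<close>
  define e where "e = (\<lambda>p. Complex (\<tau> (snd p)) ((1 - 2 * fst p) * sqrt (1 - (\<tau> (snd p))\<^sup>2)))"
  have norm_e: "(norm (e (s, t)))\<^sup>2 = (\<tau> t)\<^sup>2 + (1 - 2 * s)\<^sup>2 * (1 - (\<tau> t)\<^sup>2)" if "t \<in> {a..b}" for s t
    using \<tau>_sq[OF that] by (simp add: e_def cmod_power2 power_mult_distrib)
  have e_map: "continuous_map (top_of_set ({0..1::real} \<times> {a..b})) (top_of_set (cball 0 1)) e"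
    unfolding continuous_map_subtopology_eu
  proof
    show "continuous_on ({0..1} \<times> {a..b}) e"
      unfolding e_def Complex_eq \<tau>_def using \<open>a < b\<close> by (intro continuous_intros) auto
    show "e \<in> {0..1} \<times> {a..b} \<rightarrow> cball 0 1"
    proof clarify
      fix s t :: real assume st: "s \<in> {0..1}" "t \<in> {a..b}"
      have "(1 - 2 * s)\<^sup>2 \<le> 1"
        using st(1) by (auto simp: abs_square_le_1 abs_le_iff)
      then have "(1 - 2 * s)\<^sup>2 * (1 - (\<tau> t)\<^sup>2) \<le> 1 * (1 - (\<tau> t)\<^sup>2)"
        using \<tau>_sq[OF st(2)] by (intro mult_right_mono) auto
      then have "(norm (e (s, t)))\<^sup>2 \<le> 1"
        using norm_e[OF st(2)] by simp
      then show "e (s, t) \<in> cball 0 1"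
        by (simp add: abs_square_le_1)
    qed
  qed
  have e_sphere: "norm (e (s, t)) = 1" if "t \<in> {a..b}" "(1 - 2 * s)\<^sup>2 = 1 \<or> (\<tau> t)\<^sup>2 = 1" for s t
    using norm_e[OF that(1), of s] that(2) power2_eq_1_iff[of "norm (e (s, t))"] norm_ge_zero[of "e (s, t)"]
    by auto
  have "D (e (0, t)) = u t" if t: "t \<in> {a..b}" for t
    using D(2)[OF e_sphere[OF t, of 0]] r\<tau> \<tau>_sq[OF t] by (simp add: l_def e_def)
  moreover have "D (e (1, t)) = v t" if t: "t \<in> {a..b}" for t
  proof (cases "(\<tau> t)\<^sup>2 = 1")
    case True
    \<comment> \<open>The two half circles meet here, and \<open>l\<close> is given by \<open>u\<close>.\<close>
    then have "t = a \<or> t = b"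
      using r\<tau>[of t] r_ends by (auto simp: power2_eq_1_iff)
    with True show ?thesis
      using D(2)[OF e_sphere[OF t, of 1]] r\<tau> ends by (auto simp: l_def e_def)
  next
    case False
    then show ?thesis
      using D(2)[OF e_sphere[OF t, of 1]] r\<tau> \<tau>_sq[OF t] by (simp add: l_def e_def)
  qed
  moreover have "D (e (s, a)) = u a" "D (e (s, b)) = u b" for s
    using D(2)[OF e_sphere[of a s]] D(2)[OF e_sphere[of b s]] \<open>a < b\<close>
    by (simp_all add: e_def l_def \<tau>_ends r_ends)
  ultimately show ?thesis
    using continuous_map_compose[OF e_map D(1)] \<open>a < b\<close>
    by (subst homotopic_rel_ends_iff) (auto intro!: exI[of _ "D \<circ> e"])
qed

section \<open>Lifting paths along shy maps\<close>

definition lifts_up_to_homotopy ::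
    "'a topology \<Rightarrow> 'b topology \<Rightarrow> ('a \<Rightarrow> 'b) \<Rightarrow> (real \<Rightarrow> 'b) \<Rightarrow> real \<Rightarrow> real \<Rightarrow> 'a \<Rightarrow> 'a \<Rightarrow> bool" where
  "lifts_up_to_homotopy X Y F g a b x x' \<longleftrightarrow>
     (\<exists>q. continuous_map (top_of_set {a..b}) X q \<and> q a = x \<and> q b = x' \<and>
          homotopic_rel_ends Y a b g (F \<circ> q))"

lemma shy_map_lift_small_path:
  assumes shy: "shy_map X Y F" and surj: "F ` topspace X = topspace Y"
    and small: "\<And>l. continuous_map circle_top (subtopology Y N) l \<Longrightarrow> nullhomotopic_loop Y l"
    and g: "continuous_map (top_of_set {a..b}) (subtopology Y N) g" and "a < b"
    and x: "x \<in> topspace X" "F x = g a" "x' \<in> topspace X" "F x' = g b"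
  shows "lifts_up_to_homotopy X Y F g a b x x'"
proof -
  let ?S = "g ` {a..b}"
  define T where "T = {x \<in> topspace X. F x \<in> ?S}"
  have gY: "continuous_map (top_of_set {a..b}) Y g" and S: "?S \<subseteq> N" "?S \<subseteq> topspace Y"
    using g continuous_map_image_subset_topspace[OF g]
    by (auto simp: continuous_map_in_subtopology)
  have "path_connectedin (top_of_set {a..b}) {a..b}"
    by (simp add: path_connectedin_subtopology)
  then have "path_connectedin Y ?S"
    by (rule path_connectedin_continuous_map_image[OF gY])
  then have "path_connectedin X T"
    using shy surj S(2) by (simp add: shy_map_def T_def)
  moreover have "x \<in> T" "x' \<in> T"
    using x \<open>a < b\<close> by (auto simp: T_def)
  ultimately obtain p where p: "pathin X p" "p \<in> {0..1} \<rightarrow> T" "p 0 = x" "p 1 = x'"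
    unfolding path_connectedin by metis
  define q where "q = p \<circ> (\<lambda>t. (t - a) / (b - a))"
  have "continuous_map (top_of_set {a..b}) (top_of_set {0..1}) (\<lambda>t. (t - a) / (b - a))"
    unfolding continuous_map_subtopology_eu using \<open>a < b\<close>
    by (intro conjI continuous_intros) (auto simp: field_simps)
  then have q: "continuous_map (top_of_set {a..b}) X q"
    using p(1) by (simp only: q_def pathin_def continuous_map_compose)
  have "(F \<circ> q) t \<in> ?S" if "t \<in> {a..b}" for t
    using p(2) that \<open>a < b\<close> by (auto simp: q_def T_def Pi_iff field_simps)
  with S(1) have Fq: "continuous_map (top_of_set {a..b}) (subtopology Y N) (F \<circ> q)"
    using q shy by (fastforce simp: continuous_map_in_subtopology shy_map_def
        intro: continuous_map_compose)
  have ends: "q a = x" "q b = x'"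
    using p \<open>a < b\<close> by (simp_all add: q_def)
  have "homotopic_rel_ends Y a b g (F \<circ> q)"
    by (rule homotopic_rel_ends_if_small[OF small g Fq]) (use ends x \<open>a < b\<close> in auto)
  with q ends show ?thesis
    unfolding lifts_up_to_homotopy_def by blast
qed

lemma lifts_up_to_homotopy_glue:
  assumes "a \<le> b" "b \<le> c" "lifts_up_to_homotopy X Y F g a b x x'"
    "lifts_up_to_homotopy X Y F g b c x' x''"
  shows "lifts_up_to_homotopy X Y F g a c x x''"
proof -
  obtain q where q: "continuous_map (top_of_set {a..b}) X q" "q a = x" "q b = x'"
      "homotopic_rel_ends Y a b g (F \<circ> q)"
    using assms(3) by (auto simp: lifts_up_to_homotopy_def)
  obtain r where r: "continuous_map (top_of_set {b..c}) X r" "r b = x'" "r c = x''"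
      "homotopic_rel_ends Y b c g (F \<circ> r)"
    using assms(4) by (auto simp: lifts_up_to_homotopy_def)
  define p where "p = (\<lambda>t. if t \<le> b then q t else r t)"
  have p_eq: "p t = q t" if "t \<le> b" for t
    using that by (simp add: p_def)
  have p_eq': "p t = r t" if "t \<ge> b" for t
    using that q(3) r(2) by (auto simp: p_def)
  have "continuous_map (top_of_set {a..c}) X p"
    unfolding p_def
  proof (rule continuous_map_cases_le)
    have "{a..c} \<inter> {t. t \<in> topspace (top_of_set {a..c}) \<and> t \<le> b} = {a..b}"
      "{a..c} \<inter> {t. t \<in> topspace (top_of_set {a..c}) \<and> b \<le> t} = {b..c}"
      using assms(1,2) by auto
    then show "continuous_map (subtopology (top_of_set {a..c})
          {t. t \<in> topspace (top_of_set {a..c}) \<and> t \<le> b}) X q"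
      "continuous_map (subtopology (top_of_set {a..c})
          {t. t \<in> topspace (top_of_set {a..c}) \<and> b \<le> t}) X r"
      using q(1) r(1) by (simp_all add: subtopology_subtopology)
  qed (use q(3) r(2) in auto)
  moreover have "homotopic_rel_ends Y a b g (F \<circ> p)" "homotopic_rel_ends Y b c g (F \<circ> p)"
    using q(4) r(4) assms(1,2) by (simp_all add: homotopic_rel_ends_iff p_eq p_eq')
  then have "homotopic_rel_ends Y a c g (F \<circ> p)"
    by (rule homotopic_rel_ends_glue[OF assms(1,2)])
  moreover have "p a = x" "p c = x''"
    using assms(1,2) q(2) r(3) p_eq p_eq' by auto
  ultimately show ?thesis
    unfolding lifts_up_to_homotopy_def by blast
qed

text \<open>
  Taking \<open>g\<close> to be defined on the whole line lets the short intervals of the bisection argument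
  overhang \<open>[a, b]\<close>.
\<close>

lemma shy_map_lift_path:
  fixes g :: "real \<Rightarrow> 'b"
  assumes slsc: "semilocally_simply_connected_space Y"
    and shy: "shy_map X Y F" and surj: "F ` topspace X = topspace Y"
    and g: "continuous_map euclideanreal Y g" and "a < b"
    and x: "x \<in> topspace X" "F x = g a" "x' \<in> topspace X" "F x' = g b"
  shows "lifts_up_to_homotopy X Y F g a b x x'"
proof -
  have gY: "g t \<in> topspace Y" for t
    using continuous_map_image_subset_topspace[OF g] by auto
  \<comment> \<open>Degenerate intervals are excluded, as distinct points of a fibre are not joined by a constant path.\<close>
  define P where "P = (\<lambda>a b. a < b \<longrightarrow> (\<forall>x\<in>topspace X. \<forall>x'\<in>topspace X. F x = g a \<longrightarrow> F x' = g b \<longrightarrow>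
    lifts_up_to_homotopy X Y F g a b x x'))"
  have "a \<le> b"
    using \<open>a < b\<close> by simp
  then have "P a b"
  proof (induction rule: Bolzano)
    case (trans a b c)
    show ?case
    proof (cases "a = b \<or> b = c")
      case True
      then show ?thesis using trans by auto
    next
      case False
      then have "a < b" "b < c"
        using trans by auto
      obtain z where "z \<in> topspace X" "F z = g b"
        using surj gY[of b] by (metis imageE)
      then show ?thesis
        using trans(1,2) \<open>a < b\<close> \<open>b < c\<close> unfolding P_def
        by (meson lifts_up_to_homotopy_glue less_imp_le)
    qed
  next
    case (local t)
    obtain N U where U: "openin Y U" "g t \<in> U" "U \<subseteq> N"
        and N: "\<And>l. continuous_map circle_top (subtopology Y N) l \<Longrightarrow> nullhomotopic_loop Y l"
      using slsc gY[of t] unfolding semilocally_simply_connected_space_def by metis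
    have "open {s. g s \<in> U}"
      using openin_continuous_map_preimage[OF g U(1)] by simp
    then obtain d where d: "d > 0" "\<And>s. dist s t < d \<Longrightarrow> g s \<in> U"
      using U(2) unfolding open_dist by auto
    have "P a b" if "a \<le> t" "t \<le> b" "b - a < d" for a b
    proof -
      have "g s \<in> N" if "s \<in> {a..b}" for s
        using that \<open>a \<le> t\<close> \<open>t \<le> b\<close> \<open>b - a < d\<close> d(2)[of s] U(3) by (auto simp: dist_real_def)
      then have "continuous_map (top_of_set {a..b}) (subtopology Y N) g"
        using g by (auto simp: continuous_map_in_subtopology intro: continuous_map_from_subtopology)
      then show ?thesis
        using shy_map_lift_small_path[OF shy surj N] by (auto simp: P_def)
    qed
    with d(1) show ?case by blast
  qed
  with x \<open>a < b\<close> show ?thesis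
    by (simp add: P_def)
qed

section \<open>Closing paths up to loops\<close>

lemma cis_2pi_image: "(\<lambda>t. cis (2 * pi * t)) ` {0..1} = sphere 0 1"
proof
  show "sphere 0 1 \<subseteq> (\<lambda>t. cis (2 * pi * t)) ` {0..1}"
  proof
    fix z :: complex assume "z \<in> sphere 0 1"
    then have "z = cis (2 * pi * (Arg2pi z / (2 * pi)))"
      using Arg2pi_eq[of z] by (simp add: cis_conv_exp)
    moreover have "Arg2pi z / (2 * pi) \<in> {0..1}"
      using Arg2pi_ge_0[of z] Arg2pi_lt_2pi[of z] by simp
    ultimately show "z \<in> (\<lambda>t. cis (2 * pi * t)) ` {0..1}"
      by blast
  qed
qed auto

lemma cis_2pi_eqD:
  assumes "cis (2 * pi * s) = cis (2 * pi * t)" "s \<in> {0..1}" "t \<in> {0..1}"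
  shows "s = t \<or> {s, t} = {0, 1}"
proof -
  have "cis (2 * pi * s - 2 * pi * t) = 1"
    using assms(1) by (simp flip: cis_divide)
  then have "cos (2 * pi * s - 2 * pi * t) = 1"
    by (metis cis.sel(1) one_complex.sel(1))
  then obtain n :: int where "2 * pi * s - 2 * pi * t = of_int n * (2 * pi)"
    using cos_one_2pi_int by auto
  then have "2 * pi * (s - t) = 2 * pi * of_int n"
    by (simp add: algebra_simps)
  then have n: "s - t = of_int n"
    by simp
  then have "\<bar>of_int n :: real\<bar> \<le> 1"
    using assms(2,3) by auto
  then have "n = 0 \<or> n = 1 \<or> n = -1"
    by linarith
  with n assms(2,3) show ?thesis
    by auto
qed

text \<open>
  The circle is the quotient of \<open>[0, 1]\<close> that identifies the ends, and the product with a compact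
  space of parameters is still a quotient.
\<close>

lemma quotient_map_cis_2pi:
  assumes "compact K"
  shows "quotient_map (top_of_set (K \<times> {0..1})) (top_of_set (K \<times> sphere 0 1))
           (\<lambda>p. (fst p :: 'a::metric_space, cis (2 * pi * snd p)))"
proof (rule T1_Spaces.continuous_imp_quotient_map)
  have "continuous_on (K \<times> {0..1}) (\<lambda>p. (fst p, cis (2 * pi * snd p)))"
    by (intro continuous_intros)
  then show "continuous_map (top_of_set (K \<times> {0..1})) (top_of_set (K \<times> sphere 0 1))
          (\<lambda>p. (fst p, cis (2 * pi * snd p)))"
    unfolding continuous_map_subtopology_eu by auto
  show "compact_space (top_of_set (K \<times> {0..1::real}))"
    by (simp add: compact_space_subtopology compact_Times assms)
  show "Hausdorff_space (top_of_set (K \<times> sphere (0::complex) 1))"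
    by (simp add: Hausdorff_space_subtopology)
  show "(\<lambda>p. (fst p, cis (2 * pi * snd p))) ` topspace (top_of_set (K \<times> {0..1})) =
        topspace (top_of_set (K \<times> sphere 0 1))"
    by (force simp flip: cis_2pi_image)
qed

lemma closed_path_factors_through_circle:
  assumes "continuous_map (top_of_set {0..1}) X q" "q 0 = q 1"
  obtains p where "continuous_map circle_top X p" "\<And>t. t \<in> {0..1} \<Longrightarrow> p (cis (2 * pi * t)) = q t"
proof -
  have "quotient_map (top_of_set {0..1}) circle_top (\<lambda>t. cis (2 * pi * t))"
  proof (rule T1_Spaces.continuous_imp_quotient_map)
    have "continuous_on {0..1} (\<lambda>t. cis (2 * pi * t))"
      by (intro continuous_intros)
    then show "continuous_map (top_of_set {0..1}) circle_top (\<lambda>t. cis (2 * pi * t))"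
      by auto
  qed (simp_all add: Hausdorff_space_subtopology compact_space_subtopology cis_2pi_image)
  then show thesis
  proof (rule quotient_map_lift_exists[OF _ assms(1)])
    fix s t assume "s \<in> topspace (top_of_set {0..1})" "t \<in> topspace (top_of_set {0..1})"
      "cis (2 * pi * s) = cis (2 * pi * t)"
    then show "q s = q t"
      using cis_2pi_eqD[of s t] assms(2) by (auto simp: doubleton_eq_iff)
  qed (use that in auto)
qed

lemma homotopic_loops_if_homotopic_paths:
  assumes hom: "homotopic_rel_ends Y 0 1 (\<lambda>t. f (cis (2 * pi * t))) (\<lambda>t. f' (cis (2 * pi * t)))"
  shows "homotopic_with (\<lambda>h. h 1 = f 1) circle_top Y f f'"
proof -
  let ?e = "\<lambda>p::real\<times>real. (fst p, cis (2 * pi * snd p))"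
  obtain h where h: "continuous_map (top_of_set ({0..1::real} \<times> {0..1})) Y h"
      "\<forall>t\<in>{0..1}. h (0, t) = f (cis (2 * pi * t))" "\<forall>t\<in>{0..1}. h (1, t) = f' (cis (2 * pi * t))"
      "\<forall>s\<in>{0..1}. h (s, 0) = f 1 \<and> h (s, 1) = f 1"
    using hom by (auto simp: homotopic_rel_ends_iff)
  obtain k where k: "continuous_map (top_of_set ({0..1::real} \<times> sphere 0 1)) Y k"
      "\<And>p. p \<in> topspace (top_of_set ({0..1::real} \<times> {0..1})) \<Longrightarrow> k (?e p) = h p"
  proof (rule quotient_map_lift_exists[OF quotient_map_cis_2pi h(1)])
    fix p p' :: "real \<times> real"
    assume "p \<in> topspace (top_of_set ({0..1::real} \<times> {0..1}))"
      "p' \<in> topspace (top_of_set ({0..1::real} \<times> {0..1}))" "?e p = ?e p'"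
    then show "h p = h p'"
      using cis_2pi_eqD[of "snd p" "snd p'"] h(4)
      by (cases p; cases p') (auto simp: doubleton_eq_iff)
  qed auto
  have k_eq: "k (s, cis (2 * pi * t)) = h (s, t)" if "s \<in> {0..1}" "t \<in> {0..1}" for s t
    using k(2)[of "(s, t)"] that by simp
  have on_circle: "\<exists>t\<in>{0..1}. z = cis (2 * pi * t)" if "z \<in> sphere 0 1" for z
    using that by (auto simp flip: cis_2pi_image)
  have "k (0, z) = f z" "k (1, z) = f' z" if z: "z \<in> sphere 0 1" for z
    using on_circle[OF z] k_eq h(2,3) by auto
  moreover have "k (s, 1) = f 1" if "s \<in> {0..1}" for s
    using k_eq[of s 0] h(4) that by simp
  ultimately show ?thesis
    using k(1) by (subst homotopic_with) (auto intro!: exI[of _ k])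
qed

section \<open>The induced homomorphism\<close>

lemma shy_map_lift_loop:
  assumes slsc: "semilocally_simply_connected_space Y"
    and shy: "shy_map X Y F" and surj: "F ` topspace X = topspace Y"
    and x0: "x0 \<in> topspace X" "F x0 = y0" and f: "f \<in> pointed_loops Y y0"
  obtains p where "p \<in> pointed_loops X x0" "F \<circ> p \<in> loop_class Y y0 f"
proof -
  let ?g = "\<lambda>t. f (cis (2 * pi * t))"
  have f': "continuous_map circle_top Y f" "f 1 = y0"
    using f by (auto simp: pointed_loops_def)
  have "continuous_on UNIV (\<lambda>t. cis (2 * pi * t))"
    by (intro continuous_intros)
  then have "continuous_map euclideanreal circle_top (\<lambda>t. cis (2 * pi * t))"
    by (simp add: continuous_map_in_subtopology)
  then have "continuous_map euclideanreal Y ?g"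
    using continuous_map_compose[OF _ f'(1)] by (auto simp: o_def)
  then have "lifts_up_to_homotopy X Y F ?g 0 1 x0 x0"
    by (intro shy_map_lift_path[OF slsc shy surj]) (use x0 f' in auto)
  then obtain q where q: "continuous_map (top_of_set {0..1}) X q" "q 0 = x0" "q 1 = x0"
      "homotopic_rel_ends Y 0 1 ?g (F \<circ> q)"
    by (auto simp: lifts_up_to_homotopy_def)
  obtain p where p: "continuous_map circle_top X p"
      "\<And>t. t \<in> {0..1} \<Longrightarrow> p (cis (2 * pi * t)) = q t"
    using closed_path_factors_through_circle[OF q(1)] q(2,3) by metis
  have "homotopic_rel_ends Y 0 1 ?g (\<lambda>t. (F \<circ> p) (cis (2 * pi * t)))"
    using q(4) p(2) by (simp add: homotopic_rel_ends_iff)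
  then have "homotopic_with (\<lambda>h. h 1 = f 1) circle_top Y f (F \<circ> p)"
    by (rule homotopic_loops_if_homotopic_paths)
  then have "F \<circ> p \<in> loop_class Y y0 f"
    using f'(2) by (simp add: loop_class_def)
  moreover have "p \<in> pointed_loops X x0"
    using p(1) p(2)[of 0] q(2) by (simp add: pointed_loops_def)
  ultimately show thesis
    by (rule that[rotated])
qed

lemma loop_join_pointed_loops:
  assumes "f \<in> pointed_loops X x0" "g \<in> pointed_loops X x0"
  shows "loop_join f g \<in> pointed_loops X x0"
proof -
  \<comment> \<open>Continuity comes with the constant homotopy of \<open>loop_join f g\<close>.\<close>
  have "loop_join f g \<in> loop_class X x0 (loop_join f g)"
    using assms by (intro loop_join_cong_class loop_class_self)
  then have "continuous_map circle_top X (loop_join f g)"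
    by (auto simp: loop_class_def dest: homotopic_with_imp_continuous_maps)
  then show ?thesis
    using assms by (simp add: pointed_loops_def loop_join_def)
qed

lemma induced_hom_hom:
  assumes F: "continuous_map X Y F" "F x0 = y0"
  shows "induced_hom Y y0 F \<in> hom (fundamental_group X x0) (fundamental_group Y y0)"
proof -
  have comp: "F \<circ> f \<in> pointed_loops Y y0" if "f \<in> pointed_loops X x0" for f
    using that F by (auto simp: pointed_loops_def intro: continuous_map_compose)
  have join: "F \<circ> loop_join f g = loop_join (F \<circ> f) (F \<circ> g)" for f g
    by (auto simp: loop_join_def)
  show ?thesis
  proof (rule homI)
    fix c assume "c \<in> carrier (fundamental_group X x0)"
    then show "induced_hom Y y0 F c \<in> carrier (fundamental_group Y y0)"
      using comp by (auto simp: fundamental_group_def induced_hom_class[OF F])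
  next
    fix c d assume "c \<in> carrier (fundamental_group X x0)" "d \<in> carrier (fundamental_group X x0)"
    then obtain f g where fg: "f \<in> pointed_loops X x0" "g \<in> pointed_loops X x0"
        "c = loop_class X x0 f" "d = loop_class X x0 g"
      by (auto simp: fundamental_group_def)
    then show "induced_hom Y y0 F (c \<otimes>\<^bsub>fundamental_group X x0\<^esub> d) =
        induced_hom Y y0 F c \<otimes>\<^bsub>fundamental_group Y y0\<^esub> induced_hom Y y0 F d"
      by (simp add: fundamental_group_mult loop_join_pointed_loops induced_hom_class[OF F] comp join)
  qed
qed

theorem theorem2p3:
  fixes X :: "'a topology" and Y :: "'b topology" and F :: "'a \<Rightarrow> 'b"
    and x0 :: 'a and y0 :: 'b
  assumes "semilocally_simply_connected_space Y"
    and "shy_map X Y F"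
    and "F ` topspace X = topspace Y"
    and "x0 \<in> topspace X" and "y0 \<in> topspace Y" and "F x0 = y0"
  shows "induced_hom Y y0 F \<in> epi (fundamental_group X x0) (fundamental_group Y y0)"
proof -
  have F: "continuous_map X Y F"
    using assms(2) by (simp add: shy_map_def)
  have hom: "induced_hom Y y0 F \<in> hom (fundamental_group X x0) (fundamental_group Y y0)"
    using F assms(6) by (rule induced_hom_hom)
  have "loop_class Y y0 f \<in> induced_hom Y y0 F ` carrier (fundamental_group X x0)"
    if f: "f \<in> pointed_loops Y y0" for f
  proof -
    obtain p where p: "p \<in> pointed_loops X x0" "F \<circ> p \<in> loop_class Y y0 f"
      using shy_map_lift_loop[OF assms(1-4,6) f] .
    have "induced_hom Y y0 F (loop_class X x0 p) = loop_class Y y0 f"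
      using induced_hom_class[OF F assms(6) p(1)] loop_class_eq[OF p(2)] by simp
    moreover have "loop_class X x0 p \<in> carrier (fundamental_group X x0)"
      using p(1) by (simp add: fundamental_group_def)
    ultimately show ?thesis
      by (metis imageI)
  qed
  then have "carrier (fundamental_group Y y0) \<subseteq>
      induced_hom Y y0 F ` carrier (fundamental_group X x0)"
    by (auto simp: fundamental_group_def)
  with hom show ?thesis
    by (auto simp: epi_def hom_def)
qed

end
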